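(* Let $\boldsymbol{x}=(x_1,\ldots,x_N)\in\operatorname{int}\mathcal{C}^\flat_{\boldsymbol{a}}$, where the interior is taken in $\mathbb{R}^{d\times N}$. Then \[\{x_1,\ldots,x_N\}=\operatorname{ext}(\operatorname{conv}\{x_1,\ldots,x_N\})\quad\text{and}\quad \#\{x_1,\ldots,x_N\}=\#\operatorname{ext}(\operatorname{conv}\{x_1,\ldots,x_N\})=N.\]
   Context: Let $d\ge 2$, let $N\in\mathbb{N}$ with $N>1$, and let $a_1,\ldots,a_N\in\mathbb{R}^d$ be pairwise distinct with Euclidean norm $\|a_i\|=1$ for all $i$; write $\boldsymbol{a}=(a_1,\ldots,a_N)\in\mathbb{R}^{d\times N}$. Elements of $\mathbb{R}^{d\times N}$ are tuples $\boldsymbol{x}=(x_1,\ldots,x_N)$ with $x_i\in\mathbb{R}^d$. Define \[\mathcal{C}^\flat_{\boldsymbol{a}}:=\{\boldsymbol{x}\in\mathbb{R}^{d\times N}: a_i^Tx_j\le a_i^Tx_i\ \text{for all}\ i\ne j\}.\] $\operatorname{ext}(K)$ denotes the set of extremal (extreme) points of a convex compact set $K$, $\operatorname{conv}$ the convex hull, and $\#$ cardinality. *)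

theory Defs
  imports "HOL-Analysis.Analysis"
begin

text \<open>
  An \<open>N\<close>-tuple of points of \<open>d\<close>-dimensional Euclidean space is an element \<open>x\<close> of
  \<open>(real ^ 'd) ^ 'n\<close> with entries \<open>x $ i\<close>, where \<open>d = CARD('d)\<close> and \<open>N = CARD('n)\<close>.
  The topology of this type is the product, hence the usual Euclidean, topology.
\<close>

definition C_flat :: "(real ^ 'd) ^ 'n \<Rightarrow> ((real ^ 'd) ^ 'n) set" where
  "C_flat a = {x. \<forall>i j. i \<noteq> j \<longrightarrow> a $ i \<bullet> x $ j \<le> a $ i \<bullet> x $ i}"

definition ext :: "'a::real_vector set \<Rightarrow> 'a set" where
  "ext K = {p. p extreme_point_of K}"

end

theory Submission
  imports Defs
begin

text \<open>
  Perturbing \<open>x\<^sub>j\<close> in the direction \<open>a\<^sub>i\<close> shows that all the defining inequalities of \<open>C_flat a\<close>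
  are strict at an interior point. Hence the linear functional \<open>a\<^sub>i\<close>, restricted to the points
  \<open>x\<^sub>j\<close>, has its unique maximum at \<open>x\<^sub>i\<close>, so \<open>x\<^sub>i\<close> is not in the convex hull of the others.
\<close>

lemma interior_C_flat_strict:
  fixes a x :: "(real ^ 'd) ^ 'n"
  assumes x: "x \<in> interior (C_flat a)" and a: "a $ i \<noteq> 0" and ij: "i \<noteq> j"
  shows "a $ i \<bullet> x $ j < a $ i \<bullet> x $ i"
proof -
  obtain e where e: "e > 0" "ball x e \<subseteq> C_flat a"
    using x by (auto simp: mem_interior)
  define t where "t = e / (2 * norm (a $ i))"
  have t: "t > 0" using e a by (simp add: t_def)
  \<comment> \<open>Only entry \<open>j\<close> moves, by a vector of norm \<open>e / 2\<close>. As
    \<open>i \<noteq> j\<close>, the value of \<open>a $ i\<close> at entry \<open>i\<close> is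
    unchanged, while at entry \<open>j\<close> it grows by
    \<open>t * (a $ i \<bullet> a $ i)\<close>.\<close>
  define y where "y = x + axis j (t *\<^sub>R a $ i)"
  have "norm (axis j (t *\<^sub>R a $ i)) = norm (t *\<^sub>R a $ i)"
    unfolding norm_eq_sqrt_inner inner_axis_axis by simp
  then have "dist x y = t * norm (a $ i)"
    using t by (simp add: y_def dist_norm)
  also have "\<dots> < e" using e a by (simp add: t_def)
  finally have "y \<in> C_flat a" using e by auto
  then have "a $ i \<bullet> y $ j \<le> a $ i \<bullet> y $ i" using ij by (simp add: C_flat_def)
  then have "a $ i \<bullet> x $ j + t * (a $ i \<bullet> a $ i) \<le> a $ i \<bullet> x $ i"
    using ij by (simp add: y_def axis_def inner_add_right)
  moreover have "t * (a $ i \<bullet> a $ i) > 0" using t a by simp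
  ultimately show ?thesis by linarith
qed

theorem theorem15:
  fixes a x :: "(real ^ 'd) ^ 'n"
  assumes "CARD('d) \<ge> 2"
    and "CARD('n) > 1"
    and "\<And>i j. i \<noteq> j \<Longrightarrow> a $ i \<noteq> a $ j"
    and "\<And>i. norm (a $ i) = 1"
    and "x \<in> interior (C_flat a)"
  shows "range (\<lambda>i. x $ i) = ext (convex hull (range (\<lambda>i. x $ i)))
    \<and> card (range (\<lambda>i. x $ i)) = CARD('n)
    \<and> card (ext (convex hull (range (\<lambda>i. x $ i)))) = CARD('n)"
proof -
  let ?X = "range (\<lambda>i. x $ i)"
  have "a $ i \<noteq> 0" for i using assms(4)[of i] by auto
  then have strict: "a $ i \<bullet> x $ j < a $ i \<bullet> x $ i" if "i \<noteq> j" for i j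
    using interior_C_flat_strict[OF assms(5)] that by blast
  have "inj (\<lambda>i. x $ i)"
    using strict by (intro injI) (metis less_irrefl)
  then have card: "card ?X = CARD('n)" by (rule card_image)
  have "x $ i \<notin> convex hull (?X - {x $ i})" for i
  proof -
    have "?X - {x $ i} \<subseteq> {y. a $ i \<bullet> y < a $ i \<bullet> x $ i}"
      by (auto intro!: strict)
    \<comment> \<open>The open half-space is convex, so it contains the hull as well, whereas
      \<open>x $ i\<close> lies on its bounding hyperplane.\<close>
    then have "convex hull (?X - {x $ i}) \<subseteq> {y. a $ i \<bullet> y < a $ i \<bullet> x $ i}"
      by (rule hull_minimal) (rule convex_halfspace_lt)
    then show ?thesis by auto
  qed
  \<comment> \<open>No point of the finite, hence compact, set \<open>?X\<close> lies in the hull of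
    the others; this convex independence makes every point extreme.\<close>
  then have "p extreme_point_of (convex hull ?X) \<longleftrightarrow> p \<in> ?X" for p
    by (intro extreme_point_of_convex_hull_convex_independent finite_imp_compact) auto
  then have "ext (convex hull ?X) = ?X" by (auto simp: ext_def)
  with card show ?thesis by simp
qed

end
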